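(* Let $K\in\mathcal K^n$ be unconditional, let $\sigma\subset[n]$ be a proper subset, and let $\sigma_j:=\sigma\setminus\{j\}$ for $j\in\sigma$ (these sets form a $(|\sigma|-1)$-cover of $\sigma$). Then $$\mathrm{vol}(K)^{|\sigma|-1}\, \mathrm{vol}\left(K\cap H_\sigma^\bot\right) \geq \frac{|\sigma|!}{n^{|\sigma|}} \prod_{j\in\sigma}\mathrm{vol}\left(K\cap(H_{\sigma_j}\oplus H_\sigma^\bot)\right).$$
   Context: $[n]=\{1,\dots,n\}$; $e_1,\dots,e_n$ is the canonical basis of $\mathbb R^n$; for $\sigma\subseteq[n]$, $H_\sigma=\langle\{e_i:i\in\sigma\}\rangle$ and $H_\sigma^\bot$ is its orthogonal complement. $\mathcal K^n$ is the set of $n$-dimensional convex bodies of $\mathbb R^n$ (convex compact sets with non-empty interior). $K$ is unconditional if $(x_1,\dots,x_n)\in K$ if and only if $(\varepsilon_1x_1,\dots,\varepsilon_nx_n)\in K$ for every choice of signs $\varepsilon_i\in\{-1,1\}$. $\mathrm{vol}$ of a section by a $d$-dimensional subspace is $d$-dimensional Lebesgue measure. An $s$-cover of $\sigma$ is a tuple of subsets of $\sigma$ such that every element of $\sigma$ belongs to exactly $s$ of them. *)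

theory Defs
  imports "HOL-Analysis.Analysis"
begin

definition convex_body :: "'a::euclidean_space set \<Rightarrow> bool" where
  "convex_body K \<longleftrightarrow> convex K \<and> compact K \<and> interior K \<noteq> {}"

definition unconditional :: "(real ^ 'n) set \<Rightarrow> bool" where
  "unconditional K \<longleftrightarrow>
     (\<forall>\<epsilon> :: 'n \<Rightarrow> real. (\<forall>i. \<epsilon> i \<in> {-1, 1}) \<longrightarrow>
        (\<forall>x. x \<in> K \<longleftrightarrow> (\<chi> i. \<epsilon> i * x $ i) \<in> K))"

definition coord_subspace :: "'n::finite set \<Rightarrow> (real ^ 'n) set" where
  "coord_subspace \<sigma> = span ((\<lambda>i. axis i 1) ` \<sigma>)"

definition orthonormal_basis :: "'a::euclidean_space set \<Rightarrow> 'a set \<Rightarrow> bool" where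
  "orthonormal_basis H B \<longleftrightarrow>
     pairwise orthogonal B \<and> (\<forall>b\<in>B. norm b = 1) \<and> span B = H"

(* For a linear subspace H of dimension d: the d-dimensional Lebesgue measure of H, regarded as
   a Borel measure on the ambient space that is concentrated on H.  It is the image of the product
   Lebesgue measure under the isometry given by an orthonormal basis of H (compare lborel_eq for
   the full space).  An orthonormal basis exists by orthonormal_basis_subspace, and by rotation
   invariance the choice does not matter.  For H = {0} the basis is empty and the result is
   the Dirac measure at 0. *)
definition subspace_lborel :: "'a::euclidean_space set \<Rightarrow> 'a measure" where
  "subspace_lborel H =
     (let B = (SOME B. orthonormal_basis H B)
      in distr (\<Pi>\<^sub>M b\<in>B. lborel) borel (\<lambda>f. \<Sum>b\<in>B. f b *\<^sub>R b))"

definition section_vol :: "'a::euclidean_space set \<Rightarrow> 'a set \<Rightarrow> real" where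
  "section_vol K H = measure (subspace_lborel H) (K \<inter> H)"

end

theory Submission
  imports Defs
begin

text \<open>
  The argument is Meyer's. Let \<open>K\<^sub>+\<close> be the part of \<open>K\<close> in the positive orthant and let
  \<open>x \<in> K\<^sub>+\<close>. The pyramids with apex \<open>x\<close> over the facets \<open>K\<^sub>+ \<inter> e\<^sub>j\<^sup>\<bottom>\<close>, for \<open>j \<in> \<sigma>\<close>, have disjoint interiors and are
  contained in \<open>K\<^sub>+\<close>, so \<open>(\<Sum>j\<in>\<sigma>. x\<^sub>j vol(K\<^sub>+ \<inter> e\<^sub>j\<^sup>\<bottom>)) \<le> n vol(K\<^sub>+)\<close>. Hence the projection
  of \<open>K\<^sub>+\<close> to \<open>H\<^sub>\<sigma>\<close> lies in an explicit simplex. Every fibre of this projection is, up to translation, contained in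
  \<open>K\<^sub>+ \<inter> H\<^sub>\<sigma>\<^sup>\<bottom>\<close>, because \<open>K\<close> is convex and unconditional, so \<open>vol(K\<^sub>+)\<close> is at most the volume of
  the simplex times \<open>vol(K\<^sub>+ \<inter> H\<^sub>\<sigma>\<^sup>\<bottom>)\<close>. The powers of two from the symmetry cancel.
\<close>

subsection \<open>Lebesgue measure on subspaces\<close>

interpretation lborel_product: product_sigma_finite "\<lambda>_. lborel :: real measure"
  by standard

text \<open>The one-dimensional \<open>lborel_real_affine\<close> acts in every factor. By
  uniqueness of product measures it is enough to check boxes, where preimages are again boxes. The
  factors \<open>c i\<close> may be negative, so reflections are covered.\<close>

lemma PiM_lborel_affine:
  fixes c t :: "'i \<Rightarrow> real"
  assumes [simp]: "finite I" and c: "\<And>i. i \<in> I \<Longrightarrow> c i \<noteq> 0"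
  shows "density (distr (\<Pi>\<^sub>M i\<in>I. lborel) (\<Pi>\<^sub>M i\<in>I. lborel) (\<lambda>f. \<lambda>i\<in>I. t i + c i * f i))
           (\<lambda>_. \<Prod>i\<in>I. ennreal \<bar>c i\<bar>) = (\<Pi>\<^sub>M i\<in>I. lborel)"
proof (rule lborel_product.PiM_eqI)
  fix A :: "'i \<Rightarrow> real set" assume "\<And>i. i \<in> I \<Longrightarrow> A i \<in> sets lborel"
  then have [measurable]: "\<And>i. i \<in> I \<Longrightarrow> A i \<in> sets borel" by simp
  have *: "ennreal \<bar>c i\<bar> * emeasure lborel ((\<lambda>x. t i + c i * x) -` A i) = emeasure lborel (A i)"
    if i: "i \<in> I" for i
  proof -
    have "emeasure lborel (A i)
        = emeasure (density (distr lborel borel (\<lambda>x. t i + c i * x)) (\<lambda>_. ennreal \<bar>c i\<bar>)) (A i)"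
      using lborel_real_affine[OF c[OF i], of "t i"] by simp
    then show ?thesis
      using i by (simp add: emeasure_density_const emeasure_distr)
  qed
  have "(\<lambda>f. \<lambda>i\<in>I. t i + c i * f i) -` Pi\<^sub>E I A \<inter> space (\<Pi>\<^sub>M i\<in>I. lborel)
      = (\<Pi>\<^sub>E i\<in>I. (\<lambda>x. t i + c i * x) -` A i)"
    by (auto simp: space_PiM PiE_iff)
  moreover have "(\<lambda>x. t i + c i * x) -` A i \<in> sets lborel" if i: "i \<in> I" for i
    using measurable_sets_borel[of "\<lambda>x. t i + c i * x" borel "A i"] i by simp
  ultimately show "emeasure (density (distr (\<Pi>\<^sub>M i\<in>I. lborel) (\<Pi>\<^sub>M i\<in>I. lborel)
        (\<lambda>f. \<lambda>i\<in>I. t i + c i * f i)) (\<lambda>_. \<Prod>i\<in>I. ennreal \<bar>c i\<bar>)) (Pi\<^sub>E I A)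
      = (\<Prod>i\<in>I. emeasure lborel (A i))"
    by (simp add: emeasure_density_const emeasure_distr sets_PiM_I_finite lborel_product.emeasure_PiM
        * flip: prod.distrib)
qed simp_all

text \<open>The form used for computations: a set is pulled back to a simpler one at the price of
  the Jacobian.\<close>

lemma emeasure_PiM_lborel_affine:
  fixes c t :: "'i \<Rightarrow> real"
  assumes "finite I" "\<And>i. i \<in> I \<Longrightarrow> c i \<noteq> 0" "A \<in> sets (\<Pi>\<^sub>M i\<in>I. lborel)"
  shows "emeasure (\<Pi>\<^sub>M i\<in>I. lborel) A = (\<Prod>i\<in>I. ennreal \<bar>c i\<bar>) *
    emeasure (\<Pi>\<^sub>M i\<in>I. lborel) {f \<in> space (\<Pi>\<^sub>M i\<in>I. lborel). (\<lambda>i\<in>I. t i + c i * f i) \<in> A}"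
proof -
  let ?T = "\<lambda>f. \<lambda>i\<in>I. t i + c i * f i" and ?P = "\<Pi>\<^sub>M i\<in>I. (lborel :: real measure)"
  have "emeasure ?P A = emeasure (density (distr ?P ?P ?T) (\<lambda>_. \<Prod>i\<in>I. ennreal \<bar>c i\<bar>)) A"
    by (subst PiM_lborel_affine) (use assms in auto)
  also have "\<dots> = (\<Prod>i\<in>I. ennreal \<bar>c i\<bar>) * emeasure ?P (?T -` A \<inter> space ?P)"
    using assms(3) by (simp add: emeasure_density_const emeasure_distr)
  finally show ?thesis
    by (simp add: vimage_def Int_def conj_commute)
qed

text \<open>The measure inside \<open>subspace_lborel\<close> with the basis as an explicit
  argument, so that two bases can be compared.\<close>

definition span_lborel :: "'a::euclidean_space set \<Rightarrow> 'a measure" where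
  "span_lborel B = distr (\<Pi>\<^sub>M b\<in>B. lborel) borel (\<lambda>f. \<Sum>b\<in>B. f b *\<^sub>R b)"

lemma sets_span_lborel [simp, measurable_cong]: "sets (span_lborel B) = sets borel"
  and space_span_lborel [simp]: "space (span_lborel B) = UNIV"
  by (simp_all add: span_lborel_def)

lemma emeasure_span_lborel:
  assumes "A \<in> sets borel"
  shows "emeasure (span_lborel B) A =
    emeasure (\<Pi>\<^sub>M b\<in>B. lborel) {f \<in> space (\<Pi>\<^sub>M b\<in>B. lborel). (\<Sum>b\<in>B. f b *\<^sub>R b) \<in> A}"
  using assms by (simp add: span_lborel_def emeasure_distr vimage_def Int_def conj_commute)

lemma span_lborel_Basis: "span_lborel Basis = lborel"
  unfolding span_lborel_def by (rule lborel_eq[symmetric])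

context
  fixes H :: "'a::euclidean_space set" and B :: "'a set"
  assumes B: "orthonormal_basis H B"
begin

lemma orthonormal_basis_finite: "finite B"
proof -
  have "0 \<notin> B" using B by (auto simp: orthonormal_basis_def)
  then have "independent B"
    using B pairwise_orthogonal_independent by (auto simp: orthonormal_basis_def)
  then show ?thesis by (rule independent_imp_finite)
qed

lemma orthonormal_basis_card: "card B = dim H"
proof -
  have "0 \<notin> B" using B by (auto simp: orthonormal_basis_def)
  then have "independent B"
    using B pairwise_orthogonal_independent by (auto simp: orthonormal_basis_def)
  then show ?thesis
    using B dim_span_eq_card_independent[of B] by (simp add: orthonormal_basis_def)
qed

lemma orthonormal_basis_inner: "b \<in> B \<Longrightarrow> b' \<in> B \<Longrightarrow> b \<bullet> b' = (if b = b' then 1 else 0)"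
  using B unfolding orthonormal_basis_def pairwise_def orthogonal_def
  by (auto simp: norm_eq_1)

lemma orthonormal_basis_inner_sum:
  assumes "b \<in> B"
  shows "(\<Sum>b\<in>B. f b *\<^sub>R b) \<bullet> b = f b"
proof -
  have "(\<Sum>b\<in>B. f b *\<^sub>R b) \<bullet> b = (\<Sum>b'\<in>B. if b' = b then f b' else 0)"
    unfolding inner_sum_left by (rule sum.cong) (auto simp: orthonormal_basis_inner assms)
  then show ?thesis using assms orthonormal_basis_finite by simp
qed

lemma orthonormal_basis_expansion:
  assumes "h \<in> H"
  shows "(\<Sum>b\<in>B. (h \<bullet> b) *\<^sub>R b) = h"
proof -
  obtain f where f: "h = (\<Sum>b\<in>B. f b *\<^sub>R b)"
    using assms B span_finite[OF orthonormal_basis_finite]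
    by (auto simp: orthonormal_basis_def)
  show ?thesis
    by (subst (2) f, rule sum.cong) (simp_all add: f orthonormal_basis_inner_sum)
qed

lemma orthonormal_basis_norm: "norm (\<Sum>b\<in>B. f b *\<^sub>R b) = sqrt (\<Sum>b\<in>B. (f b)\<^sup>2)"
proof -
  have "(\<Sum>b\<in>B. f b *\<^sub>R b) \<bullet> (\<Sum>b\<in>B. f b *\<^sub>R b) = (\<Sum>b\<in>B. (f b)\<^sup>2)"
    by (subst inner_sum_right) (simp add: orthonormal_basis_inner_sum power2_eq_square)
  then show ?thesis by (simp add: norm_eq_sqrt_inner)
qed

text \<open>Reflection invariance holds only at points of \<open>H\<close>; this allows integrands
  to be rewritten under that restriction.\<close>

lemma AE_span_lborel: "AE x in span_lborel B. x \<in> H"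
proof -
  have "closed H" using B by (auto simp: orthonormal_basis_def)
  then have "H \<in> sets borel" by simp
  moreover have "(\<Sum>b\<in>B. f b *\<^sub>R b) \<in> H" for f
    using B by (auto simp: orthonormal_basis_def intro!: span_sum span_scale intro: span_base)
  ultimately show ?thesis
    unfolding span_lborel_def by (subst AE_distr_iff) auto
qed

text \<open>In coordinates this is the affine map with all factors -1, of Jacobian 1. Point
  reflections are a convenient form of invariance: two of them compose to a translation.\<close>

lemma distr_span_lborel_reflect:
  assumes h: "h \<in> H"
  shows "distr (span_lborel B) borel (\<lambda>x. h - x) = span_lborel B"
proof -
  let ?P = "\<Pi>\<^sub>M b\<in>B. (lborel :: real measure)"
  let ?E = "\<lambda>f. \<Sum>b\<in>B. f b *\<^sub>R b" and ?T = "\<lambda>f. \<lambda>b\<in>B. h \<bullet> b + -1 * f b"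
  have "h - ?E f = ?E (?T f)" for f
    using orthonormal_basis_expansion[OF h] by (simp add: scaleR_diff_left sum_subtractf)
  then have "distr (span_lborel B) borel (\<lambda>x. h - x) = distr (distr ?P ?P ?T) borel ?E"
    unfolding span_lborel_def by (simp add: distr_distr comp_def)
  also have "distr ?P ?P ?T = ?P"
    using PiM_lborel_affine[OF orthonormal_basis_finite, of "\<lambda>_. -1" "\<lambda>b. h \<bullet> b"]
    by (simp add: density_1)
  finally show ?thesis by (simp add: span_lborel_def)
qed

text \<open>Orthonormal coordinates preserve the norm, so the ball becomes a Euclidean ball in
  \<open>dim H\<close> variables. The value does not mention \<open>B\<close>, which provides the
  normalisation for uniqueness.\<close>

lemma emeasure_span_lborel_cball:
  assumes "r > 0"
  shows "emeasure (span_lborel B) (cball 0 r) = ennreal (unit_ball_vol (real (dim H)) * r ^ dim H)"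
  using emeasure_cball_aux[OF orthonormal_basis_finite assms]
  by (simp add: emeasure_span_lborel orthonormal_basis_norm orthonormal_basis_card Int_def conj_commute)

lemma sigma_finite_span_lborel: "sigma_finite_measure (span_lborel B)"
proof
  have "(\<Union>n. cball (0::'a) (real (Suc n))) = UNIV"
  proof (intro set_eqI iffI UNIV_I)
    fix x :: 'a
    obtain n where "norm x \<le> real n" using real_arch_simple by blast
    then show "x \<in> (\<Union>n. cball 0 (real (Suc n)))" by (auto intro!: exI[of _ n])
  qed
  then show "\<exists>A. countable A \<and> A \<subseteq> sets (span_lborel B) \<and> \<Union> A = space (span_lborel B) \<and>
      (\<forall>a\<in>A. emeasure (span_lborel B) a \<noteq> \<infinity>)"
    by (intro exI[of _ "range (\<lambda>n. cball 0 (real (Suc n)))"])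
      (auto simp: emeasure_span_lborel_cball simp del: of_nat_Suc)
qed

end

text \<open>
  Uniqueness of Haar measure on \<open>H\<close>: evaluate the product measure of \<open>{(x, y). x \<in> A \<and> x - y \<in> Q}\<close>
  for the unit ball \<open>Q\<close> in both orders; the measure of \<open>Q\<close> depends only on \<open>dim H\<close>.
\<close>
lemma span_lborel_unique:
  assumes B: "orthonormal_basis H B" and C: "orthonormal_basis H C"
  shows "span_lborel B = span_lborel C"
proof (rule measure_eqI)
  fix A :: "'a set" assume "A \<in> sets (span_lborel B)"
  then have [measurable]: "A \<in> sets borel" by simp
  interpret B: sigma_finite_measure "span_lborel B" by (rule sigma_finite_span_lborel[OF B])
  interpret C: sigma_finite_measure "span_lborel C" by (rule sigma_finite_span_lborel[OF C])
  interpret BC: pair_sigma_finite "span_lborel B" "span_lborel C" ..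
  have sub: "subspace H" using B by (auto simp: orthonormal_basis_def)
  define Q :: "'a set" where "Q = cball 0 1"
  have [measurable]: "Q \<in> sets borel" by (simp add: Q_def)
  have Q_uminus: "- x \<in> Q \<longleftrightarrow> x \<in> Q" for x by (simp add: Q_def)
  define \<kappa> where "\<kappa> = ennreal (unit_ball_vol (real (dim H)))"
  have \<kappa>: "\<kappa> \<noteq> 0" "\<kappa> \<noteq> \<infinity>"
    using unit_ball_vol_pos[of "real (dim H)"] by (simp_all add: \<kappa>_def del: unit_ball_vol_pos)
  have QB: "emeasure (span_lborel B) Q = \<kappa>" and QC: "emeasure (span_lborel C) Q = \<kappa>"
    using emeasure_span_lborel_cball[OF B, of 1] emeasure_span_lborel_cball[OF C, of 1]
    by (simp_all add: Q_def \<kappa>_def)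
  have refl: "(\<integral>\<^sup>+x. f (h - x) \<partial>span_lborel D) = (\<integral>\<^sup>+x. f x \<partial>span_lborel D)"
    if "orthonormal_basis H D" "h \<in> H" and [measurable]: "f \<in> borel_measurable borel"
    for D h and f :: "'a \<Rightarrow> ennreal"
  proof -
    have "(\<integral>\<^sup>+x. f x \<partial>span_lborel D) = (\<integral>\<^sup>+x. f x \<partial>distr (span_lborel D) borel (\<lambda>x. h - x))"
      by (simp add: distr_span_lborel_reflect[OF that(1,2)])
    then show ?thesis by (simp add: nn_integral_distr)
  qed
  have "emeasure (span_lborel B) A * \<kappa>
      = (\<integral>\<^sup>+x. indicator A x * (\<integral>\<^sup>+y. indicator Q (x - y) \<partial>span_lborel C) \<partial>span_lborel B)"
  proof -
    have "(\<integral>\<^sup>+x. indicator A x * (\<integral>\<^sup>+y. indicator Q (x - y) \<partial>span_lborel C) \<partial>span_lborel B)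
        = (\<integral>\<^sup>+x. indicator A x * \<kappa> \<partial>span_lborel B)"
      \<comment> \<open>For \<open>x\<close> in \<open>H\<close>, reflecting \<open>y\<close> to
        \<open>x - y\<close> turns the inner integral into the measure of \<open>Q\<close>.\<close>
      by (rule nn_integral_cong_AE, rule AE_mp[OF AE_span_lborel[OF B]])
        (auto simp: refl[OF C] QC)
    then show ?thesis by (simp add: nn_integral_multc)
  qed
  also have "\<dots> = (\<integral>\<^sup>+x. (\<integral>\<^sup>+y. indicator A x * indicator Q (x - y) \<partial>span_lborel C) \<partial>span_lborel B)"
    by (simp add: nn_integral_cmult)
  also have "\<dots> = (\<integral>\<^sup>+y. (\<integral>\<^sup>+x. indicator A x * indicator Q (x - y) \<partial>span_lborel B) \<partial>span_lborel C)"
    by (rule BC.Fubini'[symmetric]) measurable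
  \<comment> \<open>Substitute \<open>y - x\<close> for \<open>x\<close>: the argument of
    \<open>Q\<close> becomes \<open>- x\<close>, and \<open>Q\<close> is symmetric.\<close>
  also have "\<dots> = (\<integral>\<^sup>+y. (\<integral>\<^sup>+x. indicator A (y - x) * indicator Q x \<partial>span_lborel B) \<partial>span_lborel C)"
  proof (rule nn_integral_cong_AE, rule AE_mp[OF AE_span_lborel[OF C]], rule AE_I2, rule impI)
    fix y assume y: "y \<in> H"
    have "(\<integral>\<^sup>+x. indicator A x * indicator Q (x - y) \<partial>span_lborel B)
      = (\<integral>\<^sup>+x. indicator A (y - x) * indicator Q (y - x - y) \<partial>span_lborel B)"
      by (rule refl[OF B y, symmetric]) measurable
    then show "(\<integral>\<^sup>+x. indicator A x * indicator Q (x - y) \<partial>span_lborel B)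
      = (\<integral>\<^sup>+x. indicator A (y - x) * indicator Q x \<partial>span_lborel B)"
      by (simp add: Q_uminus indicator_def)
  qed
  also have "\<dots> = (\<integral>\<^sup>+x. (\<integral>\<^sup>+y. indicator A (y - x) * indicator Q x \<partial>span_lborel C) \<partial>span_lborel B)"
    by (rule BC.Fubini') measurable
  also have "\<dots> = (\<integral>\<^sup>+x. emeasure (span_lborel C) A * indicator Q x \<partial>span_lborel B)"
  proof (rule nn_integral_cong_AE, rule AE_mp[OF AE_span_lborel[OF B]], rule AE_I2, rule impI)
    fix x assume x: "x \<in> H"
    \<comment> \<open>The reflections at \<open>0\<close> and at \<open>- x\<close> together undo
      the translation by \<open>x\<close>.\<close>
    have "(\<integral>\<^sup>+y. indicator A (y - x) \<partial>span_lborel C) = (\<integral>\<^sup>+y. indicator A (0 - y - x) \<partial>span_lborel C)"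
      by (rule refl[OF C subspace_0[OF sub], symmetric]) measurable
    also have "\<dots> = (\<integral>\<^sup>+y. indicator A (- x - y) \<partial>span_lborel C)"
      by (simp only: diff_0 minus_diff_commute)
    also have "\<dots> = (\<integral>\<^sup>+y. indicator A y \<partial>span_lborel C)"
      by (rule refl[OF C subspace_neg[OF sub x]]) measurable
    finally show "(\<integral>\<^sup>+y. indicator A (y - x) * indicator Q x \<partial>span_lborel C)
        = emeasure (span_lborel C) A * indicator Q x"
      by (simp add: nn_integral_multc)
  qed
  also have "\<dots> = emeasure (span_lborel C) A * \<kappa>"
    by (simp add: nn_integral_cmult QB)
  finally show "emeasure (span_lborel B) A = emeasure (span_lborel C) A"
    using \<kappa> by (simp add: mult.commute[of _ \<kappa>] ennreal_mult_cancel_left)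
qed simp

text \<open>By uniqueness the basis picked by \<open>SOME\<close> can be replaced by any convenient
  one. The intersection with \<open>H\<close> disappears because all combinations of
  \<open>B\<close> lie in \<open>H\<close>.\<close>

lemma section_vol_eq:
  assumes B: "orthonormal_basis H B" and K: "K \<in> sets borel"
  shows "section_vol K H = measure (\<Pi>\<^sub>M b\<in>B. lborel)
    {f \<in> space (\<Pi>\<^sub>M b\<in>B. lborel). (\<Sum>b\<in>B. f b *\<^sub>R b) \<in> K}"
proof -
  have "subspace_lborel H = span_lborel (SOME B. orthonormal_basis H B)"
    by (simp add: subspace_lborel_def span_lborel_def Let_def)
  also have "\<dots> = span_lborel B"
    by (rule span_lborel_unique[OF someI[of "orthonormal_basis H", OF B] B])
  finally have *: "subspace_lborel H = span_lborel B" .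
  have "H \<in> sets borel" using B by (auto simp: orthonormal_basis_def)
  moreover have "(\<Sum>b\<in>B. f b *\<^sub>R b) \<in> H" for f
    using B by (auto simp: orthonormal_basis_def intro!: span_sum span_scale intro: span_base)
  ultimately show ?thesis
    using K by (simp add: section_vol_def * measure_def emeasure_span_lborel)
qed

subsection \<open>Sections of solid sets by the positive orthant\<close>

text \<open>The only consequence of unconditionality that the geometric part uses, phrased with
  \<open>Basis\<close> so that it makes sense in every Euclidean space.\<close>

definition solid :: "'a::euclidean_space set \<Rightarrow> bool" where
  "solid K \<longleftrightarrow> (\<forall>x\<in>K. \<forall>y. (\<forall>b\<in>Basis. \<bar>y \<bullet> b\<bar> \<le> \<bar>x \<bullet> b\<bar>) \<longrightarrow> y \<in> K)"

text \<open>Points are given by their coordinate functions on \<open>I\<close>, so that product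
  measures over different index sets can be split and merged. The strict inequalities cost only a
  null set and make the pyramids below disjoint.\<close>

definition orthant_section :: "'a::euclidean_space set \<Rightarrow> 'a set \<Rightarrow> ('a \<Rightarrow> real) set" where
  "orthant_section K I =
    {f \<in> space (\<Pi>\<^sub>M b\<in>I. lborel). (\<forall>b\<in>I. 0 < f b) \<and> (\<Sum>b\<in>I. f b *\<^sub>R b) \<in> K}"

lemma solidD: "solid K \<Longrightarrow> x \<in> K \<Longrightarrow> (\<And>b. b \<in> Basis \<Longrightarrow> \<bar>y \<bullet> b\<bar> \<le> \<bar>x \<bullet> b\<bar>) \<Longrightarrow> y \<in> K"
  by (auto simp: solid_def)

lemma inner_sum_subset_Basis:
  assumes "I \<subseteq> Basis" "b \<in> Basis"
  shows "(\<Sum>b\<in>I. f b *\<^sub>R b) \<bullet> b = (if b \<in> I then f b else 0)"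
proof -
  have "(\<Sum>b\<in>I. f b *\<^sub>R b) \<bullet> b = (\<Sum>b'\<in>I. if b' = b then f b' else 0)"
    unfolding inner_sum_left using assms by (intro sum.cong) (auto simp: inner_Basis)
  then show ?thesis using finite_subset[OF assms(1) finite_Basis] by simp
qed

lemma measurable_sum_scaleR [measurable]:
  "(\<lambda>f. \<Sum>b\<in>I. f b *\<^sub>R b) \<in> borel_measurable (\<Pi>\<^sub>M b\<in>I. (lborel :: real measure))"
  for I :: "'a::euclidean_space set"
  by measurable

lemma sets_orthant_section [measurable]:
  assumes [measurable]: "K \<in> sets borel" and [simp]: "finite I"
  shows "orthant_section K I \<in> sets (\<Pi>\<^sub>M b\<in>I. lborel)"
  unfolding orthant_section_def by measurable

lemma null_coordinate_hyperplane:
  assumes "finite I" "j \<in> I"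
  shows "emeasure (\<Pi>\<^sub>M i\<in>I. lborel) {f \<in> space (\<Pi>\<^sub>M i\<in>I. lborel). f j = (0::real)} = 0"
proof -
  have "{f \<in> space (\<Pi>\<^sub>M i\<in>I. lborel). f j = (0::real)} = (\<Pi>\<^sub>E i\<in>I. if i = j then {0} else UNIV)"
    using assms by (auto simp: space_PiM PiE_iff extensional_def split: if_splits)
  then show ?thesis
    using assms by (auto simp: lborel_product.emeasure_PiM intro!: prod_zero bexI[of _ j])
qed

text \<open>Coordinates are made positive one at a time. Each time the reflection in that coordinate
  exchanges two halves of equal measure, and the hyperplane between them is null.\<close>

lemma emeasure_section_orthant:
  assumes K [measurable]: "K \<in> sets borel" and sol: "solid K" and I: "I \<subseteq> Basis"
  shows "emeasure (\<Pi>\<^sub>M b\<in>I. lborel) {f \<in> space (\<Pi>\<^sub>M b\<in>I. lborel). (\<Sum>b\<in>I. f b *\<^sub>R b) \<in> K}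
    = 2 ^ card I * emeasure (\<Pi>\<^sub>M b\<in>I. lborel) (orthant_section K I)"
proof -
  have fin [simp]: "finite I" using I finite_subset finite_Basis by blast
  let ?P = "\<Pi>\<^sub>M b\<in>I. (lborel :: real measure)"
  let ?E = "\<lambda>f. \<Sum>b\<in>I. f b *\<^sub>R b"
  \<comment> \<open>Positivity is required only on \<open>J\<close>, so \<open>Q\<close>
    interpolates between the whole section \<open>Q {}\<close> and the orthant part
    \<open>Q I\<close>.\<close>
  define Q where "Q J = {f \<in> space ?P. (\<forall>b\<in>J. 0 < f b) \<and> ?E f \<in> K}" for J
  have Q_sets [measurable]: "Q J \<in> sets ?P" if "J \<subseteq> I" for J
  proof -
    have [simp]: "finite J" by (rule finite_subset[OF that fin])
    have "(\<lambda>f. f b) \<in> borel_measurable ?P" if "b \<in> J" for b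
      using \<open>J \<subseteq> I\<close> that by (auto intro: measurable_component_singleton)
    note [measurable] = this
    show ?thesis unfolding Q_def by measurable
  qed
  have "emeasure ?P (Q {}) = 2 ^ card J * emeasure ?P (Q J)" if "finite J" "J \<subseteq> I" for J
    using that
  proof (induction J rule: finite_induct)
    case (insert j J)
    then have j: "j \<in> I" and J: "J \<subseteq> I" and [simp]: "finite J" by auto
    note [measurable] = j
    let ?neg = "{f \<in> Q J. f j < 0}"
    have neg_sets [measurable]: "?neg \<in> sets ?P"
      using Q_sets[OF J] by measurable
    let ?c = "\<lambda>i. if i = j then - 1 else 1 :: real"
    \<comment> \<open>A sign change keeps all absolute values, so solidity gives both
      directions.\<close>
    have refl: "?E (\<lambda>i\<in>I. 0 + ?c i * f i) \<in> K \<longleftrightarrow> ?E f \<in> K" for f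
      by (rule iffI; erule solidD[OF sol]) (auto simp: inner_sum_subset_Basis[OF I])
    have "emeasure ?P ?neg = (\<Prod>i\<in>I. ennreal \<bar>?c i\<bar>) *
        emeasure ?P {f \<in> space ?P. (\<lambda>i\<in>I. 0 + ?c i * f i) \<in> ?neg}"
      by (rule emeasure_PiM_lborel_affine) auto
    also have "(\<Prod>i\<in>I. ennreal \<bar>?c i\<bar>) = 1"
      by (intro prod.neutral) auto
    also have "{f \<in> space ?P. (\<lambda>i\<in>I. 0 + ?c i * f i) \<in> ?neg} = Q (insert j J)"
    proof -
      have "(\<forall>b\<in>J. 0 < (\<lambda>i\<in>I. 0 + ?c i * f i) b) \<longleftrightarrow> (\<forall>b\<in>J. 0 < f b)" for f
        using J \<open>j \<notin> J\<close> by (intro ball_cong) auto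
      moreover have "(\<lambda>i\<in>I. 0 + ?c i * f i) \<in> space ?P" for f
        by (auto simp: space_PiM)
      ultimately show ?thesis
        unfolding Q_def mem_Collect_eq refl using j by auto
    qed
    finally have neg: "emeasure ?P ?neg = emeasure ?P (Q (insert j J))" by simp
    have "emeasure ?P (Q J) = emeasure ?P (Q (insert j J) \<union> ?neg)"
    proof (rule emeasure_eq_AE)
      have "AE f in ?P. f j \<noteq> 0"
        by (rule AE_I[OF _ null_coordinate_hyperplane[OF fin j]]) auto
      then show "AE f in ?P. f \<in> Q J \<longleftrightarrow> f \<in> Q (insert j J) \<union> ?neg"
        by eventually_elim (auto simp: Q_def)
    qed (use J insert.prems in auto)
    also have "\<dots> = emeasure ?P (Q (insert j J)) + emeasure ?P ?neg"
      by (rule plus_emeasure[symmetric, OF Q_sets[OF insert.prems] neg_sets]) (auto simp: Q_def)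
    finally show ?case
      using insert.IH[OF J] insert.hyps by (simp add: neg mult_2 mult.assoc flip: mult_2)
        (simp add: mult.left_commute)
  qed simp
  from this[OF fin subset_refl] show ?thesis
    by (simp add: Q_def orthant_section_def)
qed

section \<open>Pyramids over the coordinate facets\<close>

text \<open>The integral over the heights of a cone of height \<open>a\<close> whose
  \<open>m\<close>-dimensional slice at height \<open>y\<close> is the base shrunk by
  \<open>1 - y / a\<close>.\<close>

lemma nn_integral_power_cone:
  assumes "0 < (a::real)"
  shows "(\<integral>\<^sup>+y. ennreal ((1 - y / a) ^ m) * indicator {0<..<a} y \<partial>lborel) = ennreal (a / (m + 1))"
proof -
  have "(\<integral>\<^sup>+y. ennreal ((1 - y / a) ^ m) * indicator {0<..<a} y \<partial>lborel)
      = (\<integral>\<^sup>+y. ennreal ((1 - y / a) ^ m) * indicator {0..a} y \<partial>lborel)"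
  proof (rule nn_integral_cong_AE)
    show "AE y in lborel. ennreal ((1 - y / a) ^ m) * indicator {0<..<a} y
        = ennreal ((1 - y / a) ^ m) * indicator {0..a} y"
      using AE_lborel_singleton[of 0] AE_lborel_singleton[of a]
      by eventually_elim (auto simp: indicator_def)
  qed
  also have "\<dots> = ennreal (- (a / (m + 1)) * (1 - a / a) ^ (m + 1) - - (a / (m + 1)) * (1 - 0 / a) ^ (m + 1))"
  proof (rule nn_integral_FTC_Icc)
    fix y
    have "((\<lambda>y. 1 - y / a) has_real_derivative - 1 / a) (at y)"
      using assms by (auto intro!: derivative_eq_intros)
    from DERIV_cmult[OF DERIV_power_Suc[OF this, of m], of "- (a / (m + 1))"]
    have "((\<lambda>y. - (a / (m + 1)) * (1 - y / a) ^ (m + 1)) has_real_derivative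
        - (a / (m + 1)) * ((m + 1) * (- 1 / a * (1 - y / a) ^ m))) (at y)"
      by (simp add: add.commute)
    also have "- (a / (m + 1)) * ((m + 1) * (- 1 / a * (1 - y / a) ^ m)) = (1 - y / a) ^ m"
      using assms by (simp del: of_nat_add of_nat_Suc)
    finally show "((\<lambda>y. - (a / (m + 1)) * (1 - y / a) ^ (m + 1)) has_real_derivative (1 - y / a) ^ m) (at y)" .
  qed (use assms in auto)
  finally show ?thesis using assms by simp
qed

text \<open>
  The points \<open>g = (1 - t) y + t x\<close> with \<open>0 < t < 1\<close> and \<open>y\<close> in the facet \<open>y \<bullet> j = 0\<close>, where
  \<open>t = g j / (x \<bullet> j)\<close> and \<open>y\<close> are recovered from \<open>g\<close>.
\<close>

definition pyramid :: "'a::euclidean_space set \<Rightarrow> 'a \<Rightarrow> 'a \<Rightarrow> ('a \<Rightarrow> real) set" where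
  "pyramid K x j = {g \<in> space (\<Pi>\<^sub>M b\<in>Basis. lborel). 0 < g j \<and> g j < x \<bullet> j \<and>
    (\<lambda>b\<in>Basis - {j}. (g b - g j / (x \<bullet> j) * (x \<bullet> b)) / (1 - g j / (x \<bullet> j))) \<in> orthant_section K (Basis - {j})}"

lemma sets_pyramid [measurable]:
  assumes [measurable]: "K \<in> sets borel" "j \<in> Basis"
  shows "pyramid K x j \<in> sets (\<Pi>\<^sub>M b\<in>Basis. lborel)"
  unfolding pyramid_def by measurable

text \<open>Integrate over coordinate \<open>j\<close>. The slice at height \<open>y\<close> is a
  translate of the facet scaled by \<open>1 - y / (x \<bullet> j)\<close> in
  \<open>DIM('a) - 1\<close> coordinates, and \<open>nn_integral_power_cone\<close> sums the
  slices.\<close>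

lemma emeasure_pyramid:
  fixes x :: "'a::euclidean_space"
  assumes [measurable]: "K \<in> sets borel" and j: "j \<in> Basis" and xj: "0 < x \<bullet> j"
  shows "emeasure (\<Pi>\<^sub>M b\<in>Basis. lborel) (pyramid K x j) =
    ennreal (x \<bullet> j / DIM('a)) * emeasure (\<Pi>\<^sub>M b\<in>Basis - {j}. lborel) (orthant_section K (Basis - {j}))"
proof -
  let ?M = "Basis - {j}" and ?a = "x \<bullet> j"
  let ?P = "\<lambda>I. \<Pi>\<^sub>M b\<in>I. (lborel :: real measure)"
  let ?W = "emeasure (?P ?M) (orthant_section K ?M)"
  have Basis: "Basis = insert j ?M" using j by auto
  have card: "real DIM('a) = real (card ?M) + 1"
    using card.remove[OF finite_Basis j] by simp
  have "emeasure (?P Basis) (pyramid K x j)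
      = (\<integral>\<^sup>+g. indicator (pyramid K x j) g \<partial>?P (insert j ?M))"
    using j by (simp flip: Basis add: insert_absorb)
  also have "\<dots> = (\<integral>\<^sup>+y. (\<integral>\<^sup>+f. indicator (pyramid K x j) (f(j := y)) \<partial>?P ?M) \<partial>lborel)"
    using j by (intro lborel_product.product_nn_integral_insert_rev) (auto simp: insert_absorb)
  also have "\<dots> = (\<integral>\<^sup>+y. (ennreal ((1 - y / ?a) ^ card ?M) * indicator {0<..<?a} y) * ?W \<partial>lborel)"
  proof (rule nn_integral_cong)
    fix y :: real
    show "(\<integral>\<^sup>+f. indicator (pyramid K x j) (f(j := y)) \<partial>?P ?M)
      = (ennreal ((1 - y / ?a) ^ card ?M) * indicator {0<..<?a} y) * ?W"
    proof (cases "0 < y \<and> y < ?a")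
      case False
      then show ?thesis by (auto simp: pyramid_def)
    next
      case True
      define t where "t = y / ?a"
      have t: "0 < t" "t < 1" using True by (auto simp: t_def)
      let ?A = "{f \<in> space (?P ?M). (\<lambda>b\<in>?M. (f b - t * (x \<bullet> b)) / (1 - t)) \<in> orthant_section K ?M}"
      have [measurable]: "?A \<in> sets (?P ?M)" by measurable
      have "(\<integral>\<^sup>+f. indicator (pyramid K x j) (f(j := y)) \<partial>?P ?M) = (\<integral>\<^sup>+f. indicator ?A f \<partial>?P ?M)"
      proof (rule nn_integral_cong)
        fix f assume f: "f \<in> space (?P ?M)"
        have "f(j := y) \<in> pyramid K x j \<longleftrightarrow> f \<in> ?A"
        proof -
          have "f(j := y) \<in> space (?P Basis)"
            using f j by (auto simp: space_PiM PiE_iff extensional_def)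
          moreover have "(\<lambda>b\<in>?M. ((f(j := y)) b - (f(j := y)) j / ?a * (x \<bullet> b)) / (1 - (f(j := y)) j / ?a))
              = (\<lambda>b\<in>?M. (f b - t * (x \<bullet> b)) / (1 - t))"
            by (auto simp: t_def)
          ultimately show ?thesis using f True by (simp add: pyramid_def)
        qed
        then show "indicator (pyramid K x j) (f(j := y)) = (indicator ?A f :: ennreal)"
          by (simp add: indicator_def)
      qed
      also have "\<dots> = emeasure (?P ?M) ?A" by simp
      \<comment> \<open>The affine map here inverts the one in \<open>?A\<close>, so it pulls
        \<open>?A\<close> back to the facet itself.\<close>
      also have "\<dots> = (\<Prod>b\<in>?M. ennreal \<bar>1 - t\<bar>) *
          emeasure (?P ?M) {f \<in> space (?P ?M). (\<lambda>b\<in>?M. t * (x \<bullet> b) + (1 - t) * f b) \<in> ?A}"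
        using t by (intro emeasure_PiM_lborel_affine) auto
      also have "{f \<in> space (?P ?M). (\<lambda>b\<in>?M. t * (x \<bullet> b) + (1 - t) * f b) \<in> ?A} = orthant_section K ?M"
      proof -
        have "(\<lambda>b\<in>?M. ((\<lambda>b\<in>?M. t * (x \<bullet> b) + (1 - t) * f b) b - t * (x \<bullet> b)) / (1 - t)) = f"
          if "f \<in> space (?P ?M)" for f
          using that t by (auto simp: fun_eq_iff space_PiM PiE_iff extensional_def)
        then have "{f \<in> space (?P ?M). (\<lambda>b\<in>?M. t * (x \<bullet> b) + (1 - t) * f b) \<in> ?A}
            = {f \<in> space (?P ?M). f \<in> orthant_section K ?M}"
          by (intro Collect_cong conj_cong refl) (auto simp: space_PiM)
        then show ?thesis by (auto simp: orthant_section_def)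
      qed
      also have "(\<Prod>b\<in>?M. ennreal \<bar>1 - t\<bar>) = ennreal ((1 - t) ^ card ?M)"
        using t by (simp add: ennreal_power)
      finally have "(\<integral>\<^sup>+f. indicator (pyramid K x j) (f(j := y)) \<partial>?P ?M) = ennreal ((1 - t) ^ card ?M) * ?W" .
      moreover have "indicator {0<..<?a} y = (1::ennreal)" using True by simp
      ultimately show ?thesis by (simp only: t_def mult_1_right)
    qed
  qed
  also have "\<dots> = ennreal (?a / (card ?M + 1)) * ?W"
    by (subst nn_integral_multc) (simp_all only: nn_integral_power_cone[OF xj], measurable)
  finally show ?thesis by (simp only: card of_nat_add of_nat_1)
qed

text \<open>Each point is a convex combination of \<open>x\<close> and a facet point
  \<open>y\<close>. At \<open>j\<close> the facet contributes 0 and the weight \<open>t\<close> of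
  \<open>x\<close> yields exactly \<open>g j\<close>.\<close>

lemma pyramid_subset:
  fixes x :: "'a::euclidean_space"
  assumes K: "convex K" "x \<in> K" and x: "\<And>b. b \<in> Basis \<Longrightarrow> 0 < x \<bullet> b" and j: "j \<in> Basis"
  shows "pyramid K x j \<subseteq> orthant_section K Basis"
proof
  fix g assume g: "g \<in> pyramid K x j"
  define t where "t = g j / (x \<bullet> j)"
  define y where "y = (\<lambda>b\<in>Basis - {j}. (g b - t * (x \<bullet> b)) / (1 - t))"
  have y: "y \<in> orthant_section K (Basis - {j})" and gj: "0 < g j" "g j < x \<bullet> j"
    using g by (auto simp: pyramid_def y_def t_def)
  have t: "0 < t" "t < 1" using gj x[OF j] by (auto simp: t_def)
  have g_eq: "g b = (1 - t) * y b + t * (x \<bullet> b)" if "b \<in> Basis - {j}" for b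
    using that t by (simp add: y_def)
  have gj_eq: "g j = t * (x \<bullet> j)" using x[OF j] by (simp add: t_def)
  have "0 < g b" if "b \<in> Basis" for b
  proof (cases "b = j")
    case False
    then have "0 < y b" using y that by (auto simp: orthant_section_def)
    then show ?thesis using g_eq[of b] False that x[OF that] t by (simp add: add_pos_pos)
  qed (use gj in simp)
  moreover have "(\<Sum>b\<in>Basis. g b *\<^sub>R b) = (1 - t) *\<^sub>R (\<Sum>b\<in>Basis - {j}. y b *\<^sub>R b) + t *\<^sub>R x"
  proof (rule euclidean_eqI)
    fix b :: 'a assume b: "b \<in> Basis"
    show "(\<Sum>b\<in>Basis. g b *\<^sub>R b) \<bullet> b = ((1 - t) *\<^sub>R (\<Sum>b\<in>Basis - {j}. y b *\<^sub>R b) + t *\<^sub>R x) \<bullet> b"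
      using b g_eq[of b] gj_eq by (simp add: inner_add_left inner_sum_subset_Basis)
  qed
  moreover have "(1 - t) *\<^sub>R (\<Sum>b\<in>Basis - {j}. y b *\<^sub>R b) + t *\<^sub>R x \<in> K"
    using K y t by (intro convexD) (auto simp: orthant_section_def)
  ultimately show "g \<in> orthant_section K Basis"
    using g by (auto simp: orthant_section_def pyramid_def)
qed

text \<open>On the pyramid over facet \<open>j\<close>, the ratio \<open>g b / (x \<bullet> b)\<close> is smallest exactly at \<open>b = j\<close>.\<close>
lemma pyramid_disjoint:
  fixes x :: "'a::euclidean_space"
  assumes x: "\<And>b. b \<in> Basis \<Longrightarrow> 0 < x \<bullet> b"
  shows "disjoint_family_on (pyramid K x) Basis"
proof -
  have less: "g j / (x \<bullet> j) < g k / (x \<bullet> k)"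
    if g: "g \<in> pyramid K x j" and jk: "j \<in> Basis" "k \<in> Basis" "j \<noteq> k" for g j k
  proof -
    define t where "t = g j / (x \<bullet> j)"
    have "t < 1" using g x[OF jk(1)] by (auto simp: pyramid_def t_def)
    moreover have "0 < (g k - t * (x \<bullet> k)) / (1 - t)"
      using g jk by (auto simp: pyramid_def orthant_section_def t_def)
    ultimately have "t * (x \<bullet> k) < g k" by (simp add: zero_less_divide_iff)
    then show ?thesis using x[OF jk(2)] by (simp add: t_def pos_less_divide_eq)
  qed
  show ?thesis
    unfolding disjoint_family_on_def using less by (auto dest: less_asym) (metis less less_asym)
qed

text \<open>Disjoint pyramids with common apex of coordinates \<open>f\<close> fit into the orthant
  part of \<open>K\<close>. Read as a condition on \<open>f\<close>, this is the linear inequality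
  that cuts out the simplex.\<close>

lemma sum_pyramids_le:
  fixes K :: "'a::euclidean_space set"
  assumes [measurable]: "K \<in> sets borel" and K: "convex K" and S: "S \<subseteq> Basis"
    and f: "f \<in> orthant_section K Basis"
  shows "(\<Sum>j\<in>S. ennreal (f j / DIM('a)) *
      emeasure (\<Pi>\<^sub>M b\<in>Basis - {j}. lborel) (orthant_section K (Basis - {j})))
    \<le> emeasure (\<Pi>\<^sub>M b\<in>Basis. lborel) (orthant_section K Basis)"
proof -
  define x where "x = (\<Sum>b\<in>Basis. f b *\<^sub>R b)"
  have x: "x \<bullet> b = f b" if "b \<in> Basis" for b
    using that by (simp add: x_def)
  have xK: "x \<in> K" and pos: "\<And>b. b \<in> Basis \<Longrightarrow> 0 < x \<bullet> b"
    using f by (auto simp: orthant_section_def x_def)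
  have "(\<Sum>j\<in>S. ennreal (f j / DIM('a)) *
      emeasure (\<Pi>\<^sub>M b\<in>Basis - {j}. lborel) (orthant_section K (Basis - {j})))
    = (\<Sum>j\<in>S. emeasure (\<Pi>\<^sub>M b\<in>Basis. lborel) (pyramid K x j))"
    using S pos by (intro sum.cong) (auto simp: emeasure_pyramid x subset_iff)
  also have "\<dots> = emeasure (\<Pi>\<^sub>M b\<in>Basis. lborel) (\<Union>j\<in>S. pyramid K x j)"
    using S pyramid_disjoint[OF pos] finite_subset[OF S]
    by (intro sum_emeasure) (auto intro: disjoint_family_on_mono)
  also have "\<dots> \<le> emeasure (\<Pi>\<^sub>M b\<in>Basis. lborel) (orthant_section K Basis)"
    using pyramid_subset[OF K xK pos] S by (intro emeasure_mono) (auto simp: subset_iff)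
  finally show ?thesis .
qed

section \<open>Bounding the volume by a simplex times a fibre\<close>

text \<open>Dividing coordinate \<open>i\<close> by \<open>a i\<close> reduces the claim to the
  standard simplex, of volume \<open>1 / fact (card S)\<close>.\<close>

lemma emeasure_scaled_simplex:
  fixes a :: "'i \<Rightarrow> real"
  assumes [simp]: "finite S" and a: "\<And>i. i \<in> S \<Longrightarrow> 0 < a i"
  shows "emeasure (\<Pi>\<^sub>M i\<in>S. lborel)
      {f \<in> space (\<Pi>\<^sub>M i\<in>S. lborel). (\<forall>i\<in>S. 0 \<le> f i) \<and> (\<Sum>i\<in>S. a i * f i) \<le> 1}
    = ennreal (1 / (fact (card S) * (\<Prod>i\<in>S. a i)))"
proof -
  let ?P = "\<Pi>\<^sub>M i\<in>S. (lborel :: real measure)"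
  let ?X = "{f \<in> space ?P. (\<forall>i\<in>S. 0 \<le> f i) \<and> (\<Sum>i\<in>S. a i * f i) \<le> 1}"
  have "emeasure ?P ?X = (\<Prod>i\<in>S. ennreal \<bar>1 / a i\<bar>) *
      emeasure ?P {f \<in> space ?P. (\<lambda>i\<in>S. 0 + 1 / a i * f i) \<in> ?X}"
    using a by (intro emeasure_PiM_lborel_affine) (auto simp: less_imp_neq[symmetric])
  also have "{f \<in> space ?P. (\<lambda>i\<in>S. 0 + 1 / a i * f i) \<in> ?X}
      = {f. (\<forall>i\<in>S. 0 \<le> f i) \<and> sum f S \<le> 1} \<inter> space ?P"
  proof -
    have "(\<Sum>i\<in>S. a i * (\<lambda>i\<in>S. 0 + 1 / a i * f i) i) = sum f S" for f
      using a by (intro sum.cong) (auto simp: less_imp_neq[symmetric])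
    moreover have "(\<forall>i\<in>S. 0 \<le> (\<lambda>i\<in>S. 0 + 1 / a i * f i) i) \<longleftrightarrow> (\<forall>i\<in>S. 0 \<le> f i)" for f
      using a by (intro ball_cong) (auto simp: pos_le_divide_eq)
    ultimately show ?thesis by (auto simp: space_PiM)
  qed
  also have "emeasure ?P \<dots> = ennreal (1 / fact (card S))"
    using emeasure_std_simplex_aux[of S 1] by simp
  also have "(\<Prod>i\<in>S. ennreal \<bar>1 / a i\<bar>) = ennreal (\<Prod>i\<in>S. 1 / a i)"
    using a by (subst prod_ennreal[symmetric]) (auto intro!: prod.cong simp: less_imp_le abs_of_pos)
  finally show ?thesis
    using a by (simp add: prod_dividef prod_nonneg less_imp_le mult.commute flip: ennreal_mult)
qed

text \<open>Fubini: only base points in \<open>X\<close> have non-empty fibres, and each fibre lies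
  in \<open>Y\<close>.\<close>

lemma emeasure_PiM_le_mult:
  fixes S T :: "'i set"
  assumes ST: "S \<inter> T = {}" "finite S" "finite T"
    and [measurable]: "X \<in> sets (\<Pi>\<^sub>M i\<in>S. lborel)" "Y \<in> sets (\<Pi>\<^sub>M i\<in>T. lborel)"
    and A: "A \<in> sets (\<Pi>\<^sub>M i\<in>S \<union> T. lborel)"
    and sub: "\<And>f. f \<in> A \<Longrightarrow> restrict f S \<in> X \<and> restrict f T \<in> Y"
  shows "emeasure (\<Pi>\<^sub>M i\<in>S \<union> T. (lborel :: real measure)) A
    \<le> emeasure (\<Pi>\<^sub>M i\<in>S. lborel) X * emeasure (\<Pi>\<^sub>M i\<in>T. lborel) Y"
proof -
  let ?P = "\<lambda>I. \<Pi>\<^sub>M i\<in>I. (lborel :: real measure)"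
  have "emeasure (?P (S \<union> T)) A
      = (\<integral>\<^sup>+f. emeasure (?P T) ((\<lambda>g. merge S T (f, g)) -` A \<inter> space (?P T)) \<partial>?P S)"
    by (rule lborel_product.emeasure_fold_integral[OF ST A])
  also have "\<dots> \<le> (\<integral>\<^sup>+f. indicator X f * emeasure (?P T) Y \<partial>?P S)"
  proof (rule nn_integral_mono)
    fix f assume f: "f \<in> space (?P S)"
    have *: "f \<in> X \<and> g \<in> Y" if "merge S T (f, g) \<in> A" "g \<in> space (?P T)" for g
    proof -
      have "restrict (merge S T (f, g)) S = f" "restrict (merge S T (f, g)) T = g"
        using f that(2) ST(1) by (auto simp: space_PiM PiE_iff extensional_def fun_eq_iff merge_def)
      then show ?thesis using sub[OF that(1)] by simp
    qed
    show "emeasure (?P T) ((\<lambda>g. merge S T (f, g)) -` A \<inter> space (?P T))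
      \<le> indicator X f * emeasure (?P T) Y"
    proof (cases "f \<in> X")
      case True
      then show ?thesis using * by (auto intro!: emeasure_mono)
    next
      case False
      then have "(\<lambda>g. merge S T (f, g)) -` A \<inter> space (?P T) = {}" using * by auto
      then show ?thesis by simp
    qed
  qed
  also have "\<dots> = emeasure (?P S) X * emeasure (?P T) Y"
    by (simp add: nn_integral_multc)
  finally show ?thesis .
qed

lemma emeasure_orthant_section_finite:
  fixes K :: "'a::euclidean_space set"
  assumes "bounded K" and I: "I \<subseteq> Basis"
  shows "emeasure (\<Pi>\<^sub>M b\<in>I. lborel) (orthant_section K I) < \<infinity>"
proof -
  have fin [simp]: "finite I" using I finite_subset finite_Basis by blast
  obtain r where "0 < r" and r: "\<And>x. x \<in> K \<Longrightarrow> norm x \<le> r"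
    using \<open>bounded K\<close> by (auto simp: bounded_pos)
  have "orthant_section K I \<subseteq> (\<Pi>\<^sub>E b\<in>I. {0..r})"
  proof
    fix f assume f: "f \<in> orthant_section K I"
    have "f b \<le> r" if "b \<in> I" for b
    proof -
      have "b \<in> Basis" using that I by auto
      then have "f b = (\<Sum>b\<in>I. f b *\<^sub>R b) \<bullet> b" using that I by (simp add: inner_sum_subset_Basis)
      also have "\<dots> \<le> norm (\<Sum>b\<in>I. f b *\<^sub>R b)"
        using Basis_le_norm[OF \<open>b \<in> Basis\<close>, of "\<Sum>b\<in>I. f b *\<^sub>R b"] by simp
      also have "\<dots> \<le> r" using f r by (auto simp: orthant_section_def)
      finally show ?thesis .
    qed
    then show "f \<in> (\<Pi>\<^sub>E b\<in>I. {0..r})"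
      using f by (auto simp: orthant_section_def space_PiM PiE_iff less_imp_le)
  qed
  then have "emeasure (\<Pi>\<^sub>M b\<in>I. lborel) (orthant_section K I) \<le> emeasure (\<Pi>\<^sub>M b\<in>I. lborel) (\<Pi>\<^sub>E b\<in>I. {0..r})"
    by (intro emeasure_mono sets_PiM_I_finite) auto
  also have "\<dots> = (\<Prod>b\<in>I. emeasure lborel {0..r})"
    by (simp add: lborel_product.emeasure_PiM)
  also have "\<dots> < \<infinity>"
    using \<open>0 < r\<close> by (simp add: ennreal_power)
  finally show ?thesis .
qed

text \<open>The inequality for the orthant part, free of powers of two and with denominators
  cleared. It rearranges the bound of \<open>w Basis\<close> by the simplex volume times
  \<open>w (Basis - S)\<close>.\<close>

lemma coordinate_section_inequality:
  fixes K :: "'a::euclidean_space set"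
  defines "w \<equiv> \<lambda>I. measure (\<Pi>\<^sub>M b\<in>I. lborel) (orthant_section K I)"
  assumes K [measurable]: "K \<in> sets borel" and cvx: "convex K" and bdd: "bounded K" and sol: "solid K"
    and S: "S \<subseteq> Basis" and pos: "0 < w Basis"
  shows "fact (card S) * (\<Prod>j\<in>S. w (Basis - {j})) * w Basis
    \<le> w (Basis - S) * (real DIM('a) * w Basis) ^ card S"
\<comment> \<open>If a facet has measure 0, some \<open>a j\<close> below vanishes and the simplex
  formula fails; but then the left side is 0.\<close>
proof (cases "\<exists>j\<in>S. w (Basis - {j}) = 0")
  have [simp]: "finite S" using S finite_subset finite_Basis by blast
  case True
  then have zero: "(\<Prod>j\<in>S. w (Basis - {j})) = 0" by (simp add: prod_zero)
  have "0 \<le> w (Basis - S)" by (simp add: w_def)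
  then show ?thesis unfolding zero using pos by simp
next
  have [simp]: "finite S" using S finite_subset finite_Basis by blast
  case False
  let ?n = "real DIM('a)"
  have em: "emeasure (\<Pi>\<^sub>M b\<in>I. lborel) (orthant_section K I) = ennreal (w I)" if "I \<subseteq> Basis" for I
    using emeasure_orthant_section_finite[OF bdd that]
    unfolding w_def by (intro emeasure_eq_ennreal_measure) simp
  have w_nonneg: "0 \<le> w I" for I by (simp add: w_def)
  \<comment> \<open>These are the coefficients of \<open>sum_pyramids_le\<close> after division by
    \<open>w Basis\<close>, so that the bound becomes 1.\<close>
  define a where "a j = w (Basis - {j}) / (?n * w Basis)" for j
  have a: "0 < a j" if "j \<in> S" for j
    using False that pos w_nonneg[of "Basis - {j}"] by (auto simp: a_def zero_less_mult_iff order_less_le)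
  let ?X = "{f \<in> space (\<Pi>\<^sub>M i\<in>S. lborel). (\<forall>i\<in>S. 0 \<le> f i) \<and> (\<Sum>i\<in>S. a i * f i) \<le> 1}"
  have un: "S \<union> Basis = Basis" using S by auto
  have restr: "restrict f S \<in> ?X \<and> restrict f (Basis - S) \<in> orthant_section K (Basis - S)"
    if f: "f \<in> orthant_section K Basis" for f
  proof
    have fpos: "0 < f b" if "b \<in> Basis" for b using f that by (simp add: orthant_section_def)
    have "ennreal (\<Sum>j\<in>S. f j / ?n * w (Basis - {j})) = (\<Sum>j\<in>S. ennreal (f j / ?n) * ennreal (w (Basis - {j})))"
    proof -
      have "0 \<le> f j / ?n * w (Basis - {j})" if "j \<in> S" for j
        using fpos[of j] S that w_nonneg by (intro mult_nonneg_nonneg divide_nonneg_nonneg) auto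
      then show ?thesis
        by (simp only: ennreal_mult''[OF w_nonneg, symmetric] sum_ennreal)
    qed
    also have "\<dots> \<le> ennreal (w Basis)"
      using sum_pyramids_le[OF K cvx S f] by (simp add: em)
    finally have le: "(\<Sum>j\<in>S. f j / ?n * w (Basis - {j})) \<le> w Basis"
      using pos by (simp add: ennreal_le_iff)
    have "(\<Sum>i\<in>S. a i * f i) = (\<Sum>j\<in>S. f j / ?n * w (Basis - {j})) / w Basis"
      by (simp add: sum_divide_distrib a_def field_simps)
    also have "\<dots> \<le> 1" using le pos by simp
    finally show "restrict f S \<in> ?X"
      using fpos S by (auto simp: space_PiM less_imp_le subset_iff)
    \<comment> \<open>Setting the coordinates in \<open>S\<close> to 0 does not leave a solid set,
      so every fibre lies in the central one.\<close>
    have "(\<Sum>b\<in>Basis - S. f b *\<^sub>R b) \<in> K"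
    proof (rule solidD[OF sol])
      show "(\<Sum>b\<in>Basis. f b *\<^sub>R b) \<in> K" using f by (simp add: orthant_section_def)
    qed (simp add: inner_sum_subset_Basis)
    then show "restrict f (Basis - S) \<in> orthant_section K (Basis - S)"
      using fpos by (simp add: orthant_section_def space_PiM)
  qed
  have "ennreal (w Basis) = emeasure (\<Pi>\<^sub>M b\<in>S \<union> (Basis - S). lborel) (orthant_section K Basis)"
    by (simp add: em un)
  also have "\<dots> \<le> emeasure (\<Pi>\<^sub>M b\<in>S. lborel) ?X *
      emeasure (\<Pi>\<^sub>M b\<in>Basis - S. lborel) (orthant_section K (Basis - S))"
    using restr by (intro emeasure_PiM_le_mult) (auto simp: un)
  also have "\<dots> = ennreal (1 / (fact (card S) * (\<Prod>j\<in>S. a j)) * w (Basis - S))"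
    by (simp only: em[OF Diff_subset] emeasure_scaled_simplex[OF \<open>finite S\<close> a] ennreal_mult''[OF w_nonneg])
  finally have le: "ennreal (w Basis) \<le> ennreal (1 / (fact (card S) * (\<Prod>j\<in>S. a j)) * w (Basis - S))" .
  have prod_pos: "0 < fact (card S) * (\<Prod>j\<in>S. a j)"
    using a by (simp add: prod_pos)
  then have "0 \<le> 1 / (fact (card S) * (\<Prod>j\<in>S. a j)) * w (Basis - S)"
    by (intro mult_nonneg_nonneg w_nonneg) simp
  then have "w Basis \<le> 1 / (fact (card S) * (\<Prod>j\<in>S. a j)) * w (Basis - S)"
    using le by (simp only: ennreal_le_iff)
  then have "w Basis * (fact (card S) * (\<Prod>j\<in>S. a j)) \<le> w (Basis - S)"
    using prod_pos by (simp only: pos_le_divide_eq mult_1 times_divide_eq_left)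
  moreover have "(\<Prod>j\<in>S. a j) = (\<Prod>j\<in>S. w (Basis - {j})) / (?n * w Basis) ^ card S"
    by (simp add: a_def prod_dividef)
  ultimately show ?thesis
    using pos by (simp add: pos_divide_le_eq mult_ac)
qed

section \<open>Unconditional bodies and coordinate subspaces\<close>

lemma measure_section_orthant:
  assumes "K \<in> sets borel" "solid K" "I \<subseteq> Basis"
  shows "measure (\<Pi>\<^sub>M b\<in>I. lborel) {f \<in> space (\<Pi>\<^sub>M b\<in>I. lborel). (\<Sum>b\<in>I. f b *\<^sub>R b) \<in> K}
    = 2 ^ card I * measure (\<Pi>\<^sub>M b\<in>I. lborel) (orthant_section K I)"
proof -
  have "(2::ennreal) ^ card I = ennreal (2 ^ card I)"
    by (simp flip: ennreal_power)
  then show ?thesis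
    unfolding measure_def emeasure_section_orthant[OF assms] by (simp add: enn2real_mult)
qed

text \<open>The coordinates of \<open>x\<close> are replaced by those of \<open>y\<close> one by
  one. The new point lies on the segment between the old one and its mirror image in that
  coordinate.\<close>

lemma solid_unconditional:
  fixes K :: "(real ^ 'n) set"
  assumes cvx: "convex K" and unc: "unconditional K"
  shows "solid K"
  unfolding solid_def
proof (intro ballI allI impI)
  fix x y :: "real ^ 'n"
  assume x: "x \<in> K" and le: "\<forall>b\<in>Basis. \<bar>y \<bullet> b\<bar> \<le> \<bar>x \<bullet> b\<bar>"
  have le: "\<bar>y $ i\<bar> \<le> \<bar>x $ i\<bar>" for i
    using le[rule_format, of "axis i 1"] by (simp add: inner_axis axis_in_Basis_iff)
  have "(\<chi> i. if i \<in> J then y $ i else x $ i) \<in> K" if "finite J" for J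
    using that
  proof (induction J rule: finite_induct)
    case empty
    then show ?case using x by simp
  next
    case (insert j J)
    let ?z = "\<chi> i. if i \<in> J then y $ i else x $ i"
    let ?\<epsilon> = "\<lambda>i. if i = j then - 1 else 1 :: real"
    \<comment> \<open>The weight solves \<open>u * x $ j - (1 - u) * x $ j = y $ j\<close>. If
      \<open>x $ j = 0\<close>, division by zero gives \<open>u = 1 / 2\<close>, and
      \<open>y $ j = 0\<close> as well.\<close>
    define u where "u = (1 + y $ j / x $ j) / 2"
    have "\<bar>y $ j / x $ j\<bar> \<le> 1" using le[of j] by (simp add: divide_le_eq)
    then have u: "0 \<le> u" "0 \<le> 1 - u" by (simp_all only: u_def abs_le_iff, simp_all)
    have "u * x $ j - (1 - u) * x $ j = y $ j"
      using le[of j] by (cases "x $ j = 0") (simp_all add: u_def field_simps)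
    then have "(\<chi> i. if i \<in> insert j J then y $ i else x $ i) = u *\<^sub>R ?z + (1 - u) *\<^sub>R (\<chi> i. ?\<epsilon> i * ?z $ i)"
      using insert.hyps by (auto simp: vec_eq_iff algebra_simps)
    moreover have "(\<chi> i. ?\<epsilon> i * ?z $ i) \<in> K"
      using unc[unfolded unconditional_def, rule_format, of ?\<epsilon> ?z] insert.IH by auto
    ultimately show ?case
      using convexD[OF cvx insert.IH _ u(1,2)] by simp
  qed
  from this[of UNIV] show "y \<in> K" by simp
qed

lemma range_axis: "range (\<lambda>i. axis i (1::real)) = Basis"
  by (auto simp: Basis_vec_def)

lemma inj_axis_1: "inj (\<lambda>i. axis i (1::real))"
  by (auto simp: inj_on_def axis_eq_axis)

lemma orthonormal_basis_coord_subspace: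
  "orthonormal_basis (coord_subspace I) ((\<lambda>i. axis i 1) ` I)"
  by (auto simp: orthonormal_basis_def coord_subspace_def pairwise_def orthogonal_def inner_axis_axis)

lemma coord_subspace_eq: "coord_subspace I = {x. \<forall>i. i \<notin> I \<longrightarrow> x $ i = 0}"
proof -
  have "(\<lambda>i. axis i (1::real)) ` I \<subseteq> Basis" using range_axis by blast
  then have "coord_subspace I = {x. \<forall>b\<in>Basis. b \<notin> (\<lambda>i. axis i 1) ` I \<longrightarrow> x \<bullet> b = 0}"
    unfolding coord_subspace_def by (rule span_substd_basis)
  then show ?thesis
    by (simp add: range_axis[symmetric] inj_image_mem_iff[OF inj_axis_1] inner_axis)
qed

lemma orthogonal_comp_coord_subspace: "orthogonal_comp (coord_subspace I) = coord_subspace (- I)"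
proof (intro set_eqI iffI)
  fix x assume x: "x \<in> orthogonal_comp (coord_subspace I)"
  have "x $ i = 0" if "i \<in> I" for i
  proof -
    have "axis i 1 \<in> coord_subspace I" using that by (auto simp: coord_subspace_def intro: span_base)
    then show ?thesis using x by (auto simp: orthogonal_comp_def orthogonal_def inner_axis')
  qed
  then show "x \<in> coord_subspace (- I)" by (simp add: coord_subspace_eq)
next
  fix x :: "real ^ 'a" assume "x \<in> coord_subspace (- I)"
  then show "x \<in> orthogonal_comp (coord_subspace I)"
    unfolding coord_subspace_eq orthogonal_comp_def orthogonal_def inner_vec_def
    by (auto intro!: sum.neutral) metis
qed

lemma coord_subspace_plus: "coord_subspace I + coord_subspace J = coord_subspace (I \<union> J)"
  unfolding coord_subspace_def image_Un span_Un by (auto simp: set_plus_def)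

text \<open>Axis vectors form an orthonormal basis contained in \<open>Basis\<close>, so section
  volumes reduce to orthant measures.\<close>

lemma section_vol_coord_subspace:
  assumes "K \<in> sets borel" "solid K"
  shows "section_vol K (coord_subspace I) = 2 ^ card I *
    measure (\<Pi>\<^sub>M b\<in>(\<lambda>i. axis i 1) ` I. lborel) (orthant_section K ((\<lambda>i. axis i 1) ` I))"
proof -
  have "(\<lambda>i. axis i (1::real)) ` I \<subseteq> Basis" using range_axis by blast
  moreover have "card ((\<lambda>i. axis i (1::real)) ` I) = card I"
    by (rule card_image) (use inj_axis_1 in \<open>rule inj_on_subset, simp\<close>)
  ultimately show ?thesis
    using section_vol_eq[OF orthonormal_basis_coord_subspace assms(1)] measure_section_orthant[OF assms]
    by simp
qed

lemma measure_lebesgue_pos: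
  assumes "compact K" "interior K \<noteq> {}"
  shows "0 < measure lebesgue K"
proof -
  have "\<not> negligible K"
    using open_not_negligible[OF open_interior assms(2)] negligible_subset[OF _ interior_subset] by blast
  then show ?thesis
    using assms(1) by (simp add: negligible_iff_measure lmeasurable_compact zero_less_measure_iff)
qed

text \<open>What remains after \<open>coordinate_section_inequality\<close> is to count powers of
  two. With \<open>powi\<close>, the exponent for empty \<sigma> is -1, and both sides are then
  1.\<close>

theorem theorem1p3:
  fixes K :: "(real ^ 'n) set" and \<sigma> :: "'n set"
  assumes "convex_body K"
    and "unconditional K"
    and "\<sigma> \<subset> UNIV"
  shows "measure lebesgue K powi (int (card \<sigma>) - 1)
           * section_vol K (orthogonal_comp (coord_subspace \<sigma>))
         \<ge> fact (card \<sigma>) / real CARD('n) ^ card \<sigma>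
           * (\<Prod>j\<in>\<sigma>. section_vol K
                (coord_subspace (\<sigma> - {j}) + orthogonal_comp (coord_subspace \<sigma>)))"
proof -
  let ?e = "\<lambda>i::'n. axis i (1::real)"
  define w where "w I = measure (\<Pi>\<^sub>M b\<in>I. lborel) (orthant_section K I)" for I
  define n d where "n = CARD('n)" and "d = card \<sigma>"
  have cvx: "convex K" and cpt: "compact K" and int: "interior K \<noteq> {}"
    using assms(1) by (auto simp: convex_body_def)
  have K [measurable]: "K \<in> sets borel" using cpt by (simp add: borel_compact)
  have sol: "solid K" by (rule solid_unconditional[OF cvx assms(2)])
  have d: "card (?e ` \<sigma>) = d" and sub: "?e ` \<sigma> \<subseteq> Basis"
    using inj_axis_1 by (auto simp: d_def range_axis[symmetric] intro!: card_image inj_onI axis_eq_axis dest: injD)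
  have n: "0 < n" and "d \<le> n" by (auto simp: n_def d_def card_mono)
  have minus: "?e ` (- I) = Basis - ?e ` I" for I
    using image_set_diff[OF inj_axis_1, of UNIV I] by (simp add: range_axis Compl_eq_Diff_UNIV)
  have card_compl: "card (- I) = CARD('n) - card I" for I :: "'n set"
    by (simp add: Compl_eq_Diff_UNIV card_Diff_subset)
  have vol: "measure lebesgue K = 2 ^ n * w Basis"
  proof -
    have "measure lebesgue K = measure (span_lborel Basis) K"
      using K by (simp add: span_lborel_Basis)
    also have "\<dots> = 2 ^ n * w Basis"
      using measure_section_orthant[OF K sol subset_refl] K
      by (simp add: measure_def emeasure_span_lborel w_def n_def)
    finally show ?thesis .
  qed
  have pos: "0 < w Basis"
    using measure_lebesgue_pos[OF cpt int] by (simp add: vol zero_less_mult_iff)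
  have sec: "section_vol K (orthogonal_comp (coord_subspace \<sigma>)) = 2 ^ (n - d) * w (Basis - ?e ` \<sigma>)"
    by (simp add: orthogonal_comp_coord_subspace section_vol_coord_subspace[OF K sol] minus w_def
        n_def d_def card_compl)
  have facet: "section_vol K (coord_subspace (\<sigma> - {j}) + orthogonal_comp (coord_subspace \<sigma>))
      = 2 ^ (n - 1) * w (Basis - {?e j})" if "j \<in> \<sigma>" for j
  proof -
    \<comment> \<open>The subspace belonging to \<sigma> without \<open>j\<close> is the hyperplane
      orthogonal to \<open>?e j\<close>, whatever \<sigma> is.\<close>
    have "\<sigma> - {j} \<union> - \<sigma> = - {j}" using that by auto
    then show ?thesis
      using minus[of "{j}"]
      by (simp add: orthogonal_comp_coord_subspace coord_subspace_plus section_vol_coord_subspace[OF K sol]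
          w_def n_def card_compl)
  qed
  have prod: "(\<Prod>j\<in>\<sigma>. section_vol K (coord_subspace (\<sigma> - {j}) + orthogonal_comp (coord_subspace \<sigma>)))
      = (2 ^ (n - 1)) ^ d * (\<Prod>b\<in>?e ` \<sigma>. w (Basis - {b}))"
  proof -
    have "(\<Prod>b\<in>?e ` \<sigma>. w (Basis - {b})) = (\<Prod>j\<in>\<sigma>. w (Basis - {?e j}))"
      by (rule prod.reindex_cong[OF inj_on_subset[OF inj_axis_1]]) auto
    then show ?thesis by (simp add: facet prod.distrib d_def)
  qed
  define p where "p = (\<Prod>b\<in>?e ` \<sigma>. w (Basis - {b}))"
  have key: "fact d * p * w Basis \<le> w (Basis - ?e ` \<sigma>) * (real n * w Basis) ^ d"
    using coordinate_section_inequality[OF K cvx compact_imp_bounded[OF cpt] sol sub] pos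
    by (simp add: w_def d p_def n_def)
  \<comment> \<open>On the left the factors from \<open>K\<close> and its \<open>d\<close> facets,
    on the right those from \<open>?V ^ d\<close> and the section of dimension \<open>n - d\<close>.
    The bounds \<open>0 < n\<close> and \<open>d \<le> n\<close> control truncated
    subtraction.\<close>
  have two: "(2::real) ^ n * (2 ^ (n - 1)) ^ d = (2 ^ n) ^ d * 2 ^ (n - d)"
  proof -
    have "n + (n - 1) * d = n * d + (n - d)"
      using n \<open>d \<le> n\<close> by (cases n) auto
    then show ?thesis by (simp flip: power_mult power_add)
  qed
  let ?V = "2 ^ n * w Basis"
  \<comment> \<open>Multiplied by \<open>?V\<close>, the claim has only natural exponents; dividing
    by \<open>?V > 0\<close> afterwards produces the \<open>powi\<close>.\<close>
  have "fact d / real n ^ d * ((2 ^ (n - 1)) ^ d * p) * ?V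
      = (fact d * p * w Basis) * (2 ^ n * (2 ^ (n - 1)) ^ d) / real n ^ d"
    by simp
  also have "\<dots> \<le> (w (Basis - ?e ` \<sigma>) * (real n * w Basis) ^ d) * (2 ^ n * (2 ^ (n - 1)) ^ d) / real n ^ d"
    by (intro divide_right_mono mult_right_mono key) auto
  also have "\<dots> = ?V ^ d * (2 ^ (n - d) * w (Basis - ?e ` \<sigma>))"
    unfolding two using n by (simp add: power_mult_distrib)
  finally have "fact d / real n ^ d * ((2 ^ (n - 1)) ^ d * p)
      \<le> ?V ^ d * (2 ^ (n - d) * w (Basis - ?e ` \<sigma>)) / ?V"
    using pos by (simp add: pos_le_divide_eq)
  also have "\<dots> = ?V powi (int d - 1) * (2 ^ (n - d) * w (Basis - ?e ` \<sigma>))"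
    using pos by (simp add: power_int_diff)
  finally show ?thesis
    unfolding vol sec prod p_def n_def d_def .
qed

end
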